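(* Let $r\ge 1$ and $k_1,\ldots,k_r\in\mathbb{Z}_{\geq 1}$. The function $\eta(k_1,\ldots,k_r;s)$, defined for $\mathrm{Re}(s)>1-r$ by \[\eta(k_1,\ldots,k_r;s)=\frac{1}{\Gamma(s)}\int_{0}^\infty t^{s-1}\frac{\mathrm{Li}_{k_1,\ldots,k_r}(1-e^t)}{1-e^t}\,dt,\] can be analytically continued to an entire function on the whole complex plane, and for every $m\in\mathbb{Z}_{\ge 0}$, \[\eta(k_1,\ldots,k_r;-m)=B_m^{(k_1,\ldots,k_r)}.\] In particular, $\eta(k;-m)=B_m^{(k)}$ for $k\in\mathbb{Z}_{\ge1}$ and $m\in\mathbb{Z}_{\ge0}$.
   Context: For integers $k_1,\ldots,k_r$, the multiple polylogarithm is $\mathrm{Li}_{k_1,\ldots,k_r}(z)=\sum_{1\le m_1<\cdots<m_r} z^{m_r}/(m_1^{k_1}\cdots m_r^{k_r})$ for $|z|<1$. When all $k_i\ge1$, it extends (by iterated integration, using $\frac{d}{dz}\mathrm{Li}_{k_1,\ldots,k_r}(z)=\frac1z\mathrm{Li}_{k_1,\ldots,k_r-1}(z)$ if $k_r>1$ and $=\frac{1}{1-z}\mathrm{Li}_{k_1,\ldots,k_{r-1}}(z)$ if $k_r=1$, with $\mathrm{Li}_{\emptyset}=1$) to a single-valued holomorphic function on $\mathbb{C}\setminus[1,\infty)$; this is the meaning of $\mathrm{Li}_{k_1,\ldots,k_r}(1-e^t)$ for $t>0$. The multi-poly-Bernoulli numbers $B_n^{(k_1,\ldots,k_r)}$ are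 defined by $\frac{\mathrm{Li}_{k_1,\ldots,k_r}(1-e^{-t})}{1-e^{-t}}=\sum_{n\ge0}B_n^{(k_1,\ldots,k_r)}\frac{t^n}{n!}$. *)

theory Defs
  imports "HOL-Complex_Analysis.Complex_Analysis"
begin

definition multi_indices :: "nat \<Rightarrow> nat list set" where
  "multi_indices r = {ms. length ms = r \<and> (\<forall>m\<in>set ms. 1 \<le> m) \<and> sorted_wrt (<) ms}"

text \<open>
  The multiple polylogarithm of an index \<open>ks = [k\<^sub>1, \<dots>, k\<^sub>r]\<close> of arbitrary integers; meaningful
  for \<open>norm z < 1\<close>, where the family is absolutely summable.  Writing \<open>last (0 # ms)\<close> for
  \<open>m\<^sub>r\<close> makes the value at the empty index equal to 1.
\<close>
definition multi_polylog :: "int list \<Rightarrow> complex \<Rightarrow> complex" where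
  "multi_polylog ks z =
     (\<Sum>\<^sub>\<infinity>ms\<in>multi_indices (length ks).
        z ^ last (0 # ms) / (\<Prod>i<length ks. of_nat (ms ! i) powi (ks ! i)))"

text \<open>
  The holomorphic extension to the slit plane.  It is determined on the slit plane by the
  identity theorem, but its values on the slit are unspecified.
\<close>
definition multi_polylog_ext :: "int list \<Rightarrow> complex \<Rightarrow> complex" where
  "multi_polylog_ext ks =
     (SOME f. f holomorphic_on - (complex_of_real ` {1..}) \<and>
              (\<forall>z\<in>ball 0 1. f z = multi_polylog ks z))"

text \<open>
  The generating function identity is required for all sufficiently small \<open>t \<noteq> 0\<close>, since
  the quotient has a removable singularity at 0 (for nonempty \<open>ks\<close>).
\<close>
definition multi_poly_bernoulli :: "int list \<Rightarrow> nat \<Rightarrow> complex" where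
  "multi_poly_bernoulli ks =
     (THE B. \<forall>\<^sub>F t in at (0::complex).
        (\<lambda>n. B n * t ^ n / fact n) sums
          (multi_polylog ks (1 - exp (- t)) / (1 - exp (- t))))"

definition eta_integrand :: "int list \<Rightarrow> complex \<Rightarrow> real \<Rightarrow> complex" where
  "eta_integrand ks s t =
     complex_of_real t powr (s - 1) *
       (multi_polylog_ext ks (1 - exp (complex_of_real t)) / (1 - exp (complex_of_real t)))"

text \<open>
  The reciprocal Gamma function is used because the half-plane of convergence contains poles
  of \<open>Gamma\<close> when the index has length at least 2.
\<close>
definition eta_integral :: "int list \<Rightarrow> complex \<Rightarrow> complex" where
  "eta_integral ks s = rGamma s * (LINT t:{0<..}|lborel. eta_integrand ks s t)"

end

theory Submission
  imports Defs
begin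

text \<open>
  Put \<open>g t = Li (1 - exp t) / (1 - exp t)\<close>.  Summing over the last index turns \<open>Li\<close> into a power
  series with coefficients in \<open>[0, 1]\<close> that vanish below order \<open>r\<close>, so \<open>g\<close> has a Taylor expansion
  \<open>\<Sum>n. c n * t ^ n\<close> at 0 starting at order \<open>r - 1\<close>.  Iterated integration extends \<open>Li\<close> to the
  slit plane and shows that \<open>Li (1 - exp t)\<close> grows at most polynomially, so \<open>g\<close> decays exponentially.
  Splitting the Mellin integral at a small \<open>\<epsilon>\<close>, the part over \<open>t \<ge> \<epsilon>\<close> is entire, and the rest equals
  \<open>\<Sum>n. c n * \<epsilon> powr (s + n) / (s + n)\<close>, whose simple poles are cancelled by the zeros of the
  reciprocal Gamma function.  At \<open>s = - m\<close> only the term \<open>n = m\<close> survives and contributes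
  \<open>(-1) ^ m * fact m * c m\<close>, which is the \<open>m\<close>-th Bernoulli number because the generating function of
  these is \<open>g (- t)\<close>.
\<close>

section \<open>Power series\<close>

definition multi_indices_last :: "nat \<Rightarrow> nat \<Rightarrow> nat list set" where
  "multi_indices_last r n = {ms \<in> multi_indices r. last (0 # ms) = n}"

lemma multi_indices_last_0: "multi_indices_last 0 n = (if n = 0 then {[]} else {})"
  by (auto simp: multi_indices_last_def multi_indices_def)

lemma le_last_if_sorted_wrt:
  fixes ms :: "nat list"
  assumes "sorted_wrt (<) ms" "m \<in> set ms"
  shows "m \<le> last (0 # ms)"
  using assms by (induction ms rule: rev_induct) (auto simp: sorted_wrt_append less_imp_le)

text \<open>The last entry of a strictly increasing list is its maximum, so dropping it leaves an
  admissible list with a smaller last entry. The convention that the empty list ends in 0 makes the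
  case \<open>r = 0\<close> fit and forces \<open>n\<close> to be positive. The union is disjoint,
  which yields a recursion for sums over these sets.\<close>

lemma multi_indices_last_Suc:
  "multi_indices_last (Suc r) n = (\<Union>m<n. (\<lambda>ms. ms @ [n]) ` multi_indices_last r m)"
proof (intro equalityI subsetI)
  fix ms assume ms: "ms \<in> multi_indices_last (Suc r) n"
  then obtain ms' m where eq: "ms = ms' @ [m]"
    by (cases ms rule: rev_cases) (auto simp: multi_indices_last_def multi_indices_def)
  from ms eq have "ms' \<in> multi_indices_last r (last (0 # ms'))" "m = n" "last (0 # ms') < n"
    by (auto simp: multi_indices_last_def multi_indices_def sorted_wrt_append
        dest: bspec[of _ _ "last ms'"] split: if_splits)
  with eq show "ms \<in> (\<Union>m<n. (\<lambda>ms. ms @ [n]) ` multi_indices_last r m)" by blast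
next
  fix ms assume "ms \<in> (\<Union>m<n. (\<lambda>ms. ms @ [n]) ` multi_indices_last r m)"
  then obtain ms' where ms': "ms = ms' @ [n]" "last (0 # ms') < n" "ms' \<in> multi_indices r"
    by (auto simp: multi_indices_last_def)
  then have "m < n" if "m \<in> set ms'" for m
    using le_last_if_sorted_wrt[of ms' m] that by (auto simp: multi_indices_def)
  with ms' show "ms \<in> multi_indices_last (Suc r) n"
    by (auto simp: multi_indices_last_def multi_indices_def sorted_wrt_append)
qed

lemma finite_multi_indices_last: "finite (multi_indices_last r n)"
  by (induction r arbitrary: n) (simp_all add: multi_indices_last_0 multi_indices_last_Suc)

text \<open>The coefficient of \<open>z ^ n\<close> in the multiple polylogarithm. It is kept real
  so that sign and size can be estimated directly; the cast to the complex numbers happens in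
  \<open>polylog_fps\<close>.\<close>

definition polylog_coeff :: "int list \<Rightarrow> nat \<Rightarrow> real" where
  "polylog_coeff ks n =
     (\<Sum>ms\<in>multi_indices_last (length ks) n. inverse (\<Prod>i<length ks. real (ms ! i) powi (ks ! i)))"

lemma polylog_coeff_Nil: "polylog_coeff [] n = (if n = 0 then 1 else 0)"
  by (simp add: polylog_coeff_def multi_indices_last_0)

text \<open>In a list ending in \<open>n\<close> the last exponent affects only the factor of
  \<open>n\<close>, which can be pulled out; the rest is grouped by the second largest entry
  \<open>m < n\<close>. Reverse induction on the index rests on this recursion.\<close>

lemma polylog_coeff_snoc:
  "polylog_coeff (ks @ [k]) n = (\<Sum>m<n. polylog_coeff ks m) / real n powi k"
proof -
  define r where "r = length ks"
  have "polylog_coeff (ks @ [k]) n = 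
      (\<Sum>m<n. \<Sum>ms\<in>(\<lambda>ms. ms @ [n]) ` multi_indices_last r m.
         inverse (\<Prod>i<Suc r. real (ms ! i) powi ((ks @ [k]) ! i)))"
    unfolding polylog_coeff_def length_append_singleton multi_indices_last_Suc r_def
    by (rule sum.UNION_disjoint)
       (auto simp: finite_multi_indices_last, auto simp: multi_indices_last_def)
  also have "\<dots> = (\<Sum>m<n. polylog_coeff ks m / real n powi k)"
  proof (rule sum.cong[OF refl])
    fix m
    have "(\<Sum>ms\<in>(\<lambda>ms. ms @ [n]) ` multi_indices_last r m.
         inverse (\<Prod>i<Suc r. real (ms ! i) powi ((ks @ [k]) ! i))) =
      (\<Sum>ms\<in>multi_indices_last r m.
         inverse (\<Prod>i<Suc r. real ((ms @ [n]) ! i) powi ((ks @ [k]) ! i)))"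
      by (subst sum.reindex) (auto simp: inj_on_def)
    also have "\<dots> = (\<Sum>ms\<in>multi_indices_last r m.
         inverse (\<Prod>i<r. real (ms ! i) powi (ks ! i)) / real n powi k)"
      by (rule sum.cong[OF refl])
         (auto simp: nth_append r_def multi_indices_last_def multi_indices_def field_simps)
    finally show "(\<Sum>ms\<in>(\<lambda>ms. ms @ [n]) ` multi_indices_last r m.
         inverse (\<Prod>i<Suc r. real (ms ! i) powi ((ks @ [k]) ! i))) =
         polylog_coeff ks m / real n powi k"
      by (simp add: polylog_coeff_def r_def sum_divide_distrib)
  qed
  finally show ?thesis by (simp add: sum_divide_distrib)
qed

text \<open>By the recursion, each further index raises the order of vanishing at 0 by at least one.
  This zero of the polylogarithm is what widens the half-plane of convergence of the eta integral to
  \<open>Re s > 1 - r\<close>.\<close>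

lemma polylog_coeff_eq_0:
  "n < length ks \<Longrightarrow> polylog_coeff ks n = 0"
  by (induction ks arbitrary: n rule: rev_induct) (auto simp: polylog_coeff_snoc)

lemma polylog_coeff_nonneg: "polylog_coeff ks n \<ge> 0"
  by (auto simp: polylog_coeff_def intro!: sum_nonneg prod_nonneg)

text \<open>The recursion divides a sum of \<open>n\<close> coefficients, each at most 1, by a power
  of \<open>n\<close> with exponent at least 1. For \<open>n = 0\<close> the sum is empty and the
  coefficient is 0.\<close>

lemma polylog_coeff_le_1:
  "\<forall>k\<in>set ks. 1 \<le> k \<Longrightarrow> polylog_coeff ks n \<le> 1"
proof (induction ks arbitrary: n rule: rev_induct)
  case (snoc k ks)
  show ?case
  proof (cases "n = 0")
    case False
    have "(\<Sum>m<n. polylog_coeff ks m) \<le> (\<Sum>m<n. 1)"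
      using snoc by (intro sum_mono) auto
    also have "\<dots> = real n powi 1" by simp
    also have "\<dots> \<le> real n powi k"
      using False snoc.prems by (intro power_int_increasing) auto
    finally show ?thesis using False by (simp add: polylog_coeff_snoc)
  qed (simp add: polylog_coeff_snoc)
qed (simp add: polylog_coeff_Nil)

section \<open>The polylogarithm as a power series, and its differential equations\<close>

definition polylog_fps :: "int list \<Rightarrow> complex fps" where
  "polylog_fps ks = Abs_fps (\<lambda>n. of_real (polylog_coeff ks n))"

lemma polylog_fps_nth [simp]: "fps_nth (polylog_fps ks) n = of_real (polylog_coeff ks n)"
  by (simp add: polylog_fps_def)

lemma summable_norm_polylog:
  assumes "\<forall>k\<in>set ks. 1 \<le> k" "norm (z::complex) < 1"
  shows "summable (\<lambda>n. polylog_coeff ks n * norm z ^ n)"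
proof (rule summable_comparison_test)
  show "\<exists>N. \<forall>n\<ge>N. norm (polylog_coeff ks n * norm z ^ n) \<le> norm z ^ n"
    using polylog_coeff_le_1[OF assms(1)] polylog_coeff_nonneg
    by (auto simp: abs_mult intro!: mult_left_le_one_le)
  show "summable (\<lambda>n. norm z ^ n)" using assms by (intro summable_geometric) auto
qed

lemma polylog_fps_conv_radius:
  assumes "\<forall>k\<in>set ks. 1 \<le> k"
  shows "fps_conv_radius (polylog_fps ks) \<ge> 1"
  unfolding fps_conv_radius_def one_ereal_def
proof (rule conv_radius_geI_ex')
  fix r :: real assume "0 < r" "ereal r < ereal 1"
  with summable_norm_polylog[OF assms, of "of_real r"]
  show "summable (\<lambda>n. fps_nth (polylog_fps ks) n * of_real r ^ n)"
    by (auto simp flip: of_real_power of_real_mult intro!: summable_of_real)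
qed

text \<open>The absolutely summable family is regrouped by the last entry \<open>n\<close>: each
  group is finite and all its terms share the factor \<open>z ^ n\<close>. As the weights are
  nonnegative, absolute summability reduces to that of
  \<open>polylog_coeff ks n * norm z ^ n\<close>.\<close>

lemma multi_polylog_eq_eval_fps:
  assumes ks: "\<forall>k\<in>set ks. 1 \<le> k" and z: "norm z < 1"
  shows "multi_polylog ks z = eval_fps (polylog_fps ks) z"
proof -
  define r where "r = length ks"
  define I where "I = multi_indices_last r"
  define w where "w = (\<lambda>ms. inverse (\<Prod>i<r. real (ms ! i) powi (ks ! i)))"
  have w_nonneg: "w ms \<ge> 0" for ms unfolding w_def by (auto intro!: prod_nonneg)
  have coeff: "polylog_coeff ks n = (\<Sum>ms\<in>I n. w ms)" for n
    by (simp add: polylog_coeff_def I_def w_def r_def)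
  have fin: "finite (I n)" for n by (simp add: I_def finite_multi_indices_last)
  \<comment> \<open>A list determines its last entry, so tagging each list with it only relabels the
    index set.\<close>
  have bij: "bij_betw snd (Sigma UNIV I) (multi_indices r)"
    by (rule bij_betwI[where g = "\<lambda>ms. (last (0 # ms), ms)"])
       (auto simp: I_def multi_indices_last_def)
  define f where "f = (\<lambda>p. complex_of_real (w (snd p)) * z ^ fst p)"
  have "(\<lambda>n. norm (\<Sum>\<^sub>\<infinity>ms\<in>I n. norm (f (n, ms)))) summable_on UNIV"
  proof -
    have "(\<lambda>n. polylog_coeff ks n * norm z ^ n) summable_on UNIV"
      using summable_norm_polylog[OF ks z] polylog_coeff_nonneg
      by (intro norm_summable_imp_summable_on) (auto simp: abs_mult)
    moreover have "norm (\<Sum>\<^sub>\<infinity>ms\<in>I n. norm (f (n, ms))) = polylog_coeff ks n * norm z ^ n" for n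
      by (simp add: coeff f_def norm_mult norm_power w_nonneg fin sum_nonneg sum_distrib_right)
    ultimately show ?thesis by simp
  qed
  then have "(\<lambda>p. norm (f p)) summable_on Sigma UNIV I"
    by (subst Infinite_Sum.abs_summable_on_Sigma_iff) (auto simp: fin)
  then have sum: "(\<lambda>(n, ms). f (n, ms)) summable_on Sigma UNIV I"
    using abs_summable_summable by auto
  have "multi_polylog ks z = (\<Sum>\<^sub>\<infinity>ms\<in>multi_indices r. of_real (w ms) * z ^ last (0 # ms))"
    unfolding multi_polylog_def r_def[symmetric] w_def
    by (intro infsum_cong) (simp add: field_simps)
  also have "\<dots> = (\<Sum>\<^sub>\<infinity>p\<in>Sigma UNIV I. of_real (w (snd p)) * z ^ last (0 # snd p))"
    by (rule infsum_reindex_bij_betw[OF bij, symmetric])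
  also have "\<dots> = (\<Sum>\<^sub>\<infinity>(n,ms)\<in>Sigma UNIV I. f (n, ms))"
    by (rule infsum_cong) (auto simp: I_def multi_indices_last_def f_def)
  also have "\<dots> = (\<Sum>\<^sub>\<infinity>n. \<Sum>\<^sub>\<infinity>ms\<in>I n. f (n, ms))"
    by (rule infsum_Sigma'_banach[symmetric, OF sum])
  also have "\<dots> = (\<Sum>\<^sub>\<infinity>n. of_real (polylog_coeff ks n) * z ^ n)"
    by (simp add: coeff f_def fin sum_distrib_right)
  also have "\<dots> = (\<Sum>n. of_real (polylog_coeff ks n) * z ^ n)"
  proof (rule sums_unique[OF has_sum_imp_sums[OF has_sum_infsum]])
    show "(\<lambda>n. of_real (polylog_coeff ks n) * z ^ n) summable_on UNIV"
      using summable_norm_polylog[OF ks z] polylog_coeff_nonneg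
      by (intro norm_summable_imp_summable_on) (auto simp: norm_mult norm_power)
  qed
  finally show ?thesis by (simp add: eval_fps_def)
qed

text \<open>With last exponent 1, the coefficients of the derivative are the partial sums of
  \<open>polylog_coeff ks\<close>; multiplying by \<open>1 - fps_X\<close> takes differences of
  consecutive partial sums.\<close>

lemma polylog_fps_deriv_1:
  "fps_deriv (polylog_fps (ks @ [1])) * (1 - fps_X) = polylog_fps ks"
proof (rule fps_ext)
  fix n
  show "fps_nth (fps_deriv (polylog_fps (ks @ [1])) * (1 - fps_X)) n = fps_nth (polylog_fps ks) n"
    by (cases n) (simp_all add: right_diff_distrib polylog_coeff_snoc field_simps 
        del: of_nat_Suc flip: of_real_add of_real_diff)
qed

text \<open>Differentiating and then multiplying by \<open>fps_X\<close> multiplies the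
  \<open>n\<close>-th coefficient by \<open>n\<close>, which lowers the last exponent by
  one.\<close>

lemma polylog_fps_deriv_Suc:
  "fps_deriv (polylog_fps (ks @ [k + 1])) * fps_X = polylog_fps (ks @ [k])"
proof (rule fps_ext)
  fix n
  show "fps_nth (fps_deriv (polylog_fps (ks @ [k + 1])) * fps_X) n = fps_nth (polylog_fps (ks @ [k])) n"
    by (cases n) (simp_all add: polylog_coeff_snoc power_int_add del: of_nat_Suc)
qed

section \<open>Extension to the slit plane\<close>

abbreviation (input) slit_plane :: "complex set" where
  "slit_plane \<equiv> - (complex_of_real ` {1..})"

lemma open_slit_plane: "open slit_plane"
  using closed_slot_right by blast

lemma ball_subset_slit_plane: "ball 0 1 \<subseteq> slit_plane"
  by auto

lemma one_minus_exp_in_slit_plane: "1 - exp (complex_of_real t) \<in> slit_plane"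
proof -
  have "Re (1 - exp (complex_of_real t)) < 1" by (simp add: exp_of_real)
  then show ?thesis by force
qed

text \<open>One step of iterated integration, with growth control. The slit plane is starlike, so
  \<open>g\<close> has a primitive there; on the unit disc it agrees with \<open>F\<close> because
  both have derivative \<open>g\<close> and vanish at 0. Along \<open>1 - exp t\<close> the chain
  rule produces the factor \<open>exp t\<close>, which is why it appears in the bound assumed for
  \<open>g\<close>; integrating in \<open>t\<close> then costs one power of
  \<open>t\<close>.\<close>

lemma primitive_on_slit_plane:
  fixes F :: "complex fps" and a :: nat and C :: real
  assumes g: "g holomorphic_on slit_plane"
    and F: "fps_conv_radius F \<ge> 1" "fps_nth F 0 = 0"
    and gF: "\<And>z. norm z < 1 \<Longrightarrow> eval_fps (fps_deriv F) z = g z"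
    and C: "\<And>t::real. t \<ge> 1 \<Longrightarrow> norm (g (1 - exp (of_real t))) * exp t \<le> C * t ^ a"
  shows "\<exists>f (C'::real) (a'::nat). f holomorphic_on slit_plane \<and>
           (\<forall>z. norm z < 1 \<longrightarrow> f z = eval_fps F z) \<and>
           (\<forall>t\<ge>1. norm (f (1 - exp (of_real t))) \<le> C' * t ^ a')"
proof -
  obtain f0 where f0: "\<And>z. z \<in> slit_plane \<Longrightarrow> (f0 has_field_derivative g z) (at z)"
    using holomorphic_starlike_primitive[OF holomorphic_on_imp_continuous_on[OF g]
        starlike_slotted_complex_plane_right open_slit_plane finite.emptyI]
      holomorphic_on_imp_differentiable_at[OF g open_slit_plane] by auto
  define f where "f = (\<lambda>z. f0 z - f0 0)"
  have f: "(f has_field_derivative g z) (at z)" if "z \<in> slit_plane" for z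
    unfolding f_def by (auto intro!: derivative_eq_intros f0 that)
  have hol: "f holomorphic_on slit_plane"
    using f open_slit_plane holomorphic_on_open by blast
  have const: "\<exists>c. \<forall>z\<in>ball 0 1. f z - eval_fps F z = c"
  proof (rule has_field_derivative_zero_constant)
    fix z :: complex assume z: "z \<in> ball 0 1"
    have "norm z < fps_conv_radius F"
      using z F(1) by (simp add: less_le_trans[of "ereal (norm z)" 1] one_ereal_def)
    then show "((\<lambda>z. f z - eval_fps F z) has_field_derivative 0) (at z within ball 0 1)"
      using z ball_subset_slit_plane gF
      by (auto intro!: derivative_eq_intros has_field_derivative_at_within[OF f]
          has_field_derivative_eval_fps)
  qed auto
  have agree: "f z = eval_fps F z" if "norm z < 1" for z
  proof -
    have "f z - eval_fps F z = f 0 - eval_fps F 0"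
      using that const by (metis mem_ball_0 centre_in_ball zero_less_one)
    then show ?thesis by (simp add: f_def eval_fps_at_0 F(2))
  qed
  have "C \<ge> 0"
    using order_trans[OF mult_nonneg_nonneg[OF norm_ge_zero exp_ge_zero] C[of 1]] by simp
  \<comment> \<open>The increment from 1 to \<open>t\<close> is at most
    \<open>C * t ^ a * (t - 1)\<close>, and the value at \<open>t = 1\<close> is absorbed because
    \<open>t ^ Suc a\<close> is at least 1.\<close>
  have bound: "norm (f (1 - exp (of_real t))) \<le> (norm (f (1 - exp 1)) + C) * t ^ Suc a" 
    if t: "t \<ge> 1" for t :: real
  proof -
    have "norm (f (1 - exp (of_real t)) - f (1 - exp (of_real 1))) \<le> (C * t ^ a) * norm (t - 1)"
    proof (rule differentiable_bound[of "{1..t}"])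
      fix x :: real assume x: "x \<in> {1..t}"
      have "((f \<circ> (\<lambda>x. 1 - exp (of_real x))) has_vector_derivative
              (- exp (of_real x)) * g (1 - exp (of_real x))) (at x within {1..t})"
        by (intro field_vector_diff_chain_within has_field_derivative_at_within[OF f]
              one_minus_exp_in_slit_plane has_vector_derivative_real_field)
           (auto intro!: derivative_eq_intros)
      then show "((\<lambda>x. f (1 - exp (of_real x))) has_derivative 
          (\<lambda>h. h *\<^sub>R (- exp (of_real x) * g (1 - exp (of_real x))))) (at x within {1..t})"
        by (simp add: has_vector_derivative_def o_def)
      have "onorm (\<lambda>h. h *\<^sub>R (- exp (of_real x) * g (1 - exp (of_real x)))) \<le>
          norm (g (1 - exp (of_real x))) * exp x"
        by (rule onorm_le) (simp add: norm_mult algebra_simps)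
      also have "\<dots> \<le> C * x ^ a" using C x by auto
      also have "\<dots> \<le> C * t ^ a" using x \<open>C \<ge> 0\<close> by (intro mult_left_mono power_mono) auto
      finally show "onorm (\<lambda>h. h *\<^sub>R (- exp (of_real x) * g (1 - exp (of_real x)))) \<le> C * t ^ a" .
    qed (use t in auto)
    also have "\<dots> \<le> (C * t ^ a) * t"
      using t \<open>C \<ge> 0\<close> by (intro mult_left_mono) auto
    finally have "norm (f (1 - exp (of_real t)) - f (1 - exp 1)) \<le> C * t ^ Suc a"
      by (simp add: algebra_simps)
    moreover have "norm (f (1 - exp 1)) * 1 \<le> norm (f (1 - exp 1)) * t ^ Suc a"
      using t by (intro mult_left_mono one_le_power) auto
    ultimately show ?thesis
      using norm_triangle_sub[of "f (1 - exp (of_real t))" "f (1 - exp 1)"]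
      by (simp add: algebra_simps)
  qed
  show ?thesis using hol agree bound by blast
qed

text \<open>The outer induction appends an index entry and the inner one raises that entry from 1.
  Each stage integrates the preceding function divided by \<open>1 - z\<close> or by
  \<open>z\<close>, and the polynomial growth bound is carried along so that
  \<open>primitive_on_slit_plane\<close> applies again.\<close>

lemma polylog_extension_exists:
  assumes "\<forall>k\<in>set ks. 1 \<le> k"
  shows "\<exists>f (C::real) (a::nat). f holomorphic_on slit_plane \<and>
           (\<forall>z. norm z < 1 \<longrightarrow> f z = eval_fps (polylog_fps ks) z) \<and>
           (\<forall>t\<ge>1. norm (f (1 - exp (of_real t))) \<le> C * t ^ a)"
  using assms
proof (induction ks rule: rev_induct)
  case Nil
  have "polylog_fps [] = 1" by (auto simp: fps_eq_iff polylog_coeff_Nil)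
  then show ?case
    by (intro exI[of _ "\<lambda>_. 1"] exI[of _ 1] exI[of _ 0]) auto
next
  case (snoc k ks)
  have "\<forall>k\<in>set ks. 1 \<le> k" using snoc.prems by auto
  from snoc.IH[OF this] obtain f0 and C0 :: real and a0 :: nat where f0: "f0 holomorphic_on slit_plane"
      "\<And>z. norm z < 1 \<Longrightarrow> f0 z = eval_fps (polylog_fps ks) z"
      "\<And>t. t \<ge> 1 \<Longrightarrow> norm (f0 (1 - exp (of_real t))) \<le> C0 * t ^ a0"
    by blast
  have ks: "\<forall>k\<in>set ks. 1 \<le> k" "k \<ge> 1" using snoc.prems by auto
  have "1 \<le> k \<Longrightarrow> \<exists>f (C::real) (a::nat). f holomorphic_on slit_plane \<and>
           (\<forall>z. norm z < 1 \<longrightarrow> f z = eval_fps (polylog_fps (ks @ [k])) z) \<and>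
           (\<forall>t\<ge>1. norm (f (1 - exp (of_real t))) \<le> C * t ^ a)"
  proof (induction k rule: int_ge_induct)
    case base
    have rad: "fps_conv_radius (polylog_fps (ks @ [1])) \<ge> 1"
      using ks by (intro polylog_fps_conv_radius) auto
    show ?case
    proof (rule primitive_on_slit_plane)
      show "(\<lambda>z. f0 z / (1 - z)) holomorphic_on slit_plane"
        by (auto intro!: holomorphic_intros f0)
      show "eval_fps (fps_deriv (polylog_fps (ks @ [1]))) z = f0 z / (1 - z)"
        if z: "norm z < 1" for z
      proof -
        have z': "norm z < fps_conv_radius (fps_deriv (polylog_fps (ks @ [1])))"
          using z rad fps_conv_radius_deriv[of "polylog_fps (ks @ [1])"]
          by (meson ereal_less(3) less_le_trans order_trans)
        have "f0 z = eval_fps (fps_deriv (polylog_fps (ks @ [1])) * (1 - fps_X)) z"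
          using f0(2)[OF z] by (simp only: polylog_fps_deriv_1)
        also have "\<dots> = eval_fps (fps_deriv (polylog_fps (ks @ [1]))) z * eval_fps (1 - fps_X) z"
          by (rule eval_fps_mult[OF z']) 
             (rule less_le_trans[OF _ fps_conv_radius_diff], simp)
        also have "eval_fps (1 - fps_X) z = 1 - z"
          by (subst eval_fps_diff) auto
        finally show ?thesis using z by auto
      qed
      \<comment> \<open>At \<open>z = 1 - exp t\<close> the denominator \<open>1 - z\<close> equals
        \<open>exp t\<close>, so the two exponential factors cancel and the bound for
        \<open>f0\<close> carries over unchanged.\<close>
      show "norm (f0 (1 - exp (of_real t)) / (1 - (1 - exp (of_real t)))) * exp t \<le> C0 * t ^ a0"
        if "t \<ge> 1" for t :: real
        using f0(3)[OF that] by (simp add: norm_divide)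
    qed (use rad in \<open>auto simp: polylog_coeff_eq_0\<close>)
  next
    case (step k)
    define F where "F = polylog_fps (ks @ [k])"
    define G where "G = polylog_fps (ks @ [k + 1])"
    from step.IH obtain f and C :: real and a :: nat where f: "f holomorphic_on slit_plane"
      "\<And>z. norm z < 1 \<Longrightarrow> f z = eval_fps F z"
      "\<And>t. t \<ge> 1 \<Longrightarrow> norm (f (1 - exp (of_real t))) \<le> C * t ^ a"
      unfolding F_def by blast
    have radF: "fps_conv_radius F \<ge> 1"
      unfolding F_def using ks step.hyps by (intro polylog_fps_conv_radius) auto
    have radG: "fps_conv_radius G \<ge> 1"
      unfolding G_def using ks step.hyps by (intro polylog_fps_conv_radius) auto
    have f_0: "f 0 = 0" using f(2)[of 0] by (simp add: eval_fps_at_0 F_def polylog_coeff_eq_0)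
    have "norm (f (1 - exp (complex_of_real 1))) \<le> C" using f(3)[of 1] by simp
    then have "C \<ge> 0" using norm_ge_zero order_trans by blast
    have FG: "F = fps_deriv G * fps_X" unfolding F_def G_def by (rule polylog_fps_deriv_Suc[symmetric])
    have "\<exists>f (C::real) (a::nat). f holomorphic_on slit_plane \<and>
           (\<forall>z. norm z < 1 \<longrightarrow> f z = eval_fps G z) \<and>
           (\<forall>t\<ge>1. norm (f (1 - exp (of_real t))) \<le> C * t ^ a)"
    proof (rule primitive_on_slit_plane)
      \<comment> \<open>This is \<open>f z / z\<close> with its removable singularity filled in,
        since \<open>f 0 = 0\<close>; the differences with \<open>f 0\<close> and 0 match the shape
        of the removable singularity theorem.\<close>
      show "(\<lambda>z. if z = 0 then deriv f 0 else (f z - f 0) / (z - 0)) holomorphic_on slit_plane"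
        using f(1) open_slit_plane by (rule pole_lemma_open)
      show "eval_fps (fps_deriv G) z = (if z = 0 then deriv f 0 else (f z - f 0) / (z - 0))"
        if z: "norm z < 1" for z
      proof (cases "z = 0")
        case False
        have z': "norm z < fps_conv_radius (fps_deriv G)"
          using z radG fps_conv_radius_deriv[of G]
          by (meson ereal_less(3) less_le_trans order_trans)
        have "f z = eval_fps (fps_deriv G) z * z"
          using f(2)[OF z] z' by (simp add: FG eval_fps_mult)
        then show ?thesis using False f_0 by simp
      next
        case True
        \<comment> \<open>The filled-in value is the right one: the derivative of \<open>f\<close>
          at 0 is the linear coefficient of \<open>F = fps_deriv G * fps_X\<close>, hence the
          constant coefficient of \<open>fps_deriv G\<close>.\<close>
        have "deriv f 0 = deriv (eval_fps F) 0"
        proof (rule deriv_cong_ev)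
          have "eventually (\<lambda>z::complex. z \<in> ball 0 1) (nhds 0)"
            by (rule eventually_nhds_in_open) auto
          then show "\<forall>\<^sub>F z in nhds 0. f z = eval_fps F z"
            by eventually_elim (use f in auto)
        qed auto
        also have "\<dots> = fps_nth (fps_deriv F) 0"
          using radF by (subst eval_fps_deriv[symmetric]) 
            (auto simp: eval_fps_at_0 intro: less_le_trans[of _ 1])
        also have "\<dots> = eval_fps (fps_deriv G) 0"
          by (simp add: FG eval_fps_at_0)
        finally show ?thesis using True by simp
      qed
      \<comment> \<open>The constant doubles because \<open>exp t \<le> 2 * (exp t - 1)\<close> once
        \<open>exp t \<ge> 2\<close>.\<close>
      show "norm (if 1 - exp (of_real t) = (0::complex) then deriv f 0
           else (f (1 - exp (of_real t)) - f 0) / (1 - exp (of_real t) - 0)) * exp t \<le> (2 * C) * t ^ a"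
        if t: "t \<ge> 1" for t :: real
      proof -
        have exp: "exp t \<ge> 2" using exp_ge_add_one_self[of t] t by linarith
        have "norm (1 - exp (complex_of_real t)) = norm (complex_of_real (1 - exp t))"
          by (simp only: of_real_diff of_real_1 exp_of_real)
        then have norm: "norm (1 - exp (complex_of_real t)) = exp t - 1"
          using exp by (simp only: norm_of_real)
        have "norm (f (1 - exp (of_real t))) * exp t \<le> (C * t ^ a) * (2 * (exp t - 1))"
          using f(3)[OF t] exp \<open>C \<ge> 0\<close> t by (intro mult_mono) auto
        then have "norm (f (1 - exp (of_real t))) * exp t / (exp t - 1) \<le> 2 * C * t ^ a"
          using exp t by (simp add: pos_divide_le_eq algebra_simps)
        moreover have "1 - exp (complex_of_real t) \<noteq> 0" using norm exp by auto
        ultimately show ?thesis using f_0 by (simp add: norm_divide norm)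
      qed
    qed (use radG in \<open>auto simp: G_def polylog_coeff_eq_0\<close>)
    then show ?case by (simp add: G_def)
  qed
  then show ?case using ks by blast
qed

lemma
  assumes ks: "\<forall>k\<in>set ks. 1 \<le> k"
  shows multi_polylog_ext_holomorphic: "multi_polylog_ext ks holomorphic_on slit_plane"
    and multi_polylog_ext_eq_eval_fps:
      "norm z < 1 \<Longrightarrow> multi_polylog_ext ks z = eval_fps (polylog_fps ks) z"
    and multi_polylog_ext_growth:
      "\<exists>(C::real) (a::nat). \<forall>t\<ge>1. norm (multi_polylog_ext ks (1 - exp (of_real t))) \<le> C * t ^ a"
proof -
  obtain f and C :: real and a :: nat where f: "f holomorphic_on slit_plane"
    "\<And>z. norm z < 1 \<Longrightarrow> f z = eval_fps (polylog_fps ks) z"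
    "\<And>t. t \<ge> 1 \<Longrightarrow> norm (f (1 - exp (of_real t))) \<le> C * t ^ a"
    using polylog_extension_exists[OF ks] by blast
  have "multi_polylog_ext ks holomorphic_on slit_plane \<and>
      (\<forall>z\<in>ball 0 1. multi_polylog_ext ks z = multi_polylog ks z)"
    unfolding multi_polylog_ext_def
    by (rule someI[of _ f]) (use f multi_polylog_eq_eval_fps[OF ks] in auto)
  then show hol: "multi_polylog_ext ks holomorphic_on slit_plane"
    and eq: "norm z < 1 \<Longrightarrow> multi_polylog_ext ks z = eval_fps (polylog_fps ks) z" for z
    using multi_polylog_eq_eval_fps[OF ks] by auto
  \<comment> \<open>The chosen extension need not be the constructed \<open>f\<close> by definition,
    but the identity theorem on the connected slit plane makes them equal there, so the growth bound
    transfers.\<close>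
  have "multi_polylog_ext ks z = f z" if "z \<in> slit_plane" for z
    by (rule analytic_continuation_open[OF _ open_slit_plane _ _ ball_subset_slit_plane hol f(1) _ that])
       (auto simp: eq f starlike_imp_connected starlike_slotted_complex_plane_right)
  then show "\<exists>(C::real) (a::nat). \<forall>t\<ge>1. norm (multi_polylog_ext ks (1 - exp (of_real t))) \<le> C * t ^ a"
    using f(3) one_minus_exp_in_slit_plane by metis
qed

section \<open>Mellin transforms\<close>

lemma set_integrable_lborel_if_continuous:
  fixes f :: "real \<Rightarrow> 'a::euclidean_space"
  assumes "continuous_on A f" "A \<in> sets borel" "f absolutely_integrable_on A"
  shows "set_integrable lborel A f"
  using assms borel_measurable_continuous_on_indicator[OF assms(2,1)]
  by (auto simp: set_integrable_def integrable_completion)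

lemma norm_of_real_powr: "t \<ge> 0 \<Longrightarrow> norm (complex_of_real t powr w) = t powr Re w"
  by (subst norm_powr_real_powr) auto

lemma
  fixes \<epsilon> :: real and w :: complex
  assumes w: "Re w > 0" and \<epsilon>: "\<epsilon> > 0"
  shows set_integrable_powr: "set_integrable lborel {0<..\<epsilon>} (\<lambda>t. of_real t powr (w - 1))"
    and set_integral_powr:
      "(LINT t:{0<..\<epsilon>}|lborel. of_real t powr (w - 1)) = of_real \<epsilon> powr w / w"
    and set_integral_norm_powr:
      "(LINT t:{0<..\<epsilon>}|lborel. norm (of_real t powr (w - 1))) = \<epsilon> powr Re w / Re w"
proof -
  have real: "((\<lambda>x. x powr (Re w - 1)) has_integral (\<epsilon> powr Re w / Re w)) {0..\<epsilon>}"
    using has_integral_powr_from_0[of "Re w - 1" \<epsilon>] w \<epsilon> by simp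
  have real_int: "set_integrable lborel {0..\<epsilon>} (\<lambda>x. x powr (Re w - 1))"
  proof -
    have "(\<lambda>x. x powr (Re w - 1)) absolutely_integrable_on {0..\<epsilon>}"
      using real by (intro nonnegative_absolutely_integrable_1) auto
    moreover have "(\<lambda>x. indicator {0..\<epsilon>} x *\<^sub>R (x powr (Re w - 1))) \<in> borel_measurable borel"
      by measurable
    ultimately show ?thesis by (auto simp: set_integrable_def integrable_completion)
  qed
  \<comment> \<open>Including the endpoint 0 changes nothing even pointwise, since
    \<open>0 powr _\<close> is 0 by convention.\<close>
  have ind: "indicator {0<..\<epsilon>} t *\<^sub>R (complex_of_real t powr (w - 1)) =
      indicator {0..\<epsilon>} t *\<^sub>R (complex_of_real t powr (w - 1))" for t
    by (auto simp: indicator_def)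
  have ind_real: "indicator {0<..\<epsilon>} t *\<^sub>R norm (complex_of_real t powr (w - 1)) =
      indicator {0..\<epsilon>} t *\<^sub>R (t powr (Re w - 1))" for t
    by (auto simp: indicator_def norm_of_real_powr)
  have "(\<lambda>t. indicator {0<..\<epsilon>} t *\<^sub>R (complex_of_real t powr (w - 1))) \<in> borel_measurable borel"
    by (intro borel_measurable_continuous_on_indicator continuous_intros) auto
  then have "set_borel_measurable lborel {0..\<epsilon>} (\<lambda>t. complex_of_real t powr (w - 1))"
    by (simp add: set_borel_measurable_def ind)
  then have int: "set_integrable lborel {0..\<epsilon>} (\<lambda>t. complex_of_real t powr (w - 1))"
    by (rule set_integrable_bound[OF real_int]) (auto simp: norm_of_real_powr)
  then show "set_integrable lborel {0<..\<epsilon>} (\<lambda>t. complex_of_real t powr (w - 1))"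
    by (simp add: set_integrable_def ind)
  have "((\<lambda>t. complex_of_real t powr (w - 1)) has_integral
      (of_real \<epsilon> powr w / w - of_real 0 powr w / w)) {0..\<epsilon>}"
  proof (rule fundamental_theorem_of_calculus_interior)
    \<comment> \<open>The positive real part of \<open>w\<close> makes the antiderivative continuous
      up to 0, where it vanishes.\<close>
    show "continuous_on {0..\<epsilon>} (\<lambda>t. complex_of_real t powr w / w)"
      using w by (intro continuous_intros) auto
    fix t assume t: "t \<in> {0<..<\<epsilon>}"
    then have "((\<lambda>z. z powr w / w) has_field_derivative (of_real t powr (w - 1))) (at (of_real t))"
      using w by (auto intro!: derivative_eq_intros)
    then show "((\<lambda>t. complex_of_real t powr w / w) has_vector_derivative
        of_real t powr (w - 1)) (at t)"
      by (rule has_vector_derivative_real_field)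
  qed (use \<epsilon> in auto)
  then have "(LINT t:{0..\<epsilon>}|lborel. complex_of_real t powr (w - 1)) = of_real \<epsilon> powr w / w"
    using int by (simp add: set_borel_integral_eq_integral integral_unique)
  then show "(LINT t:{0<..\<epsilon>}|lborel. of_real t powr (w - 1)) = of_real \<epsilon> powr w / w"
    by (simp add: set_lebesgue_integral_def ind)
  have "(LINT t:{0..\<epsilon>}|lborel. t powr (Re w - 1)) = \<epsilon> powr Re w / Re w"
    using real real_int by (simp add: set_borel_integral_eq_integral integral_unique)
  then show "(LINT t:{0<..\<epsilon>}|lborel. norm (of_real t powr (w - 1))) = \<epsilon> powr Re w / Re w"
    by (simp add: set_lebesgue_integral_def ind_real del: real_scaleR_def)
qed

section \<open>Cancelling the poles by the reciprocal Gamma function, and the Mellin integral near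
  0\<close>

text \<open>The entire function \<open>\<lambda>s. rGamma s / (s + n)\<close>, written without division.\<close>
definition rGamma_quot :: "nat \<Rightarrow> complex \<Rightarrow> complex" where
  "rGamma_quot n s = pochhammer s n * rGamma (s + of_nat n + 1)"

lemma rGamma_quot_mult: "(s + of_nat n) * rGamma_quot n s = rGamma s"
proof -
  \<comment> \<open>The last of the factors \<open>s, s + 1, ..., s + n\<close> is the one to split
    off.\<close>
  have "rGamma s = pochhammer s (Suc n) * rGamma (s + of_nat (Suc n))"
    by (rule pochhammer_rGamma)
  then show ?thesis by (simp add: rGamma_quot_def pochhammer_Suc add_ac mult_ac)
qed

lemma rGamma_quot_holomorphic [holomorphic_intros]: "rGamma_quot n holomorphic_on A"
  unfolding rGamma_quot_def[abs_def] by (intro holomorphic_intros)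

text \<open>Off the diagonal the factor \<open>n - m\<close> is nonzero while \<open>rGamma\<close>
  vanishes at \<open>- m\<close>; on it the Pochhammer symbol gives the signed factorial and
  \<open>rGamma 1 = 1\<close>. At \<open>- m\<close> a series in these functions thus reduces to its
  \<open>m\<close>-th term.\<close>

lemma rGamma_quot_minus_nat:
  "rGamma_quot n (- of_nat m) = (if n = m then (-1) ^ m * fact m else 0)"
proof (cases "n = m")
  case True
  then show ?thesis by (simp add: rGamma_quot_def pochhammer_same)
next
  case False
  have "(- of_nat m + of_nat n) * rGamma_quot n (- of_nat m) = 0"
    unfolding rGamma_quot_mult by (simp add: rGamma_eq_zero_iff)
  with False show ?thesis by simp
qed

text \<open>Weierstrass M-test on closed unit discs. For large \<open>n\<close> the divisor
  \<open>s + n\<close> has modulus at least 1 throughout the disc, so \<open>rGamma_quot n\<close>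
  is bounded there by a bound for \<open>rGamma\<close> that is independent of
  \<open>n\<close>.\<close>

lemma rGamma_quot_series:
  fixes c :: "nat \<Rightarrow> complex" and \<epsilon> :: real
  assumes c: "summable (\<lambda>n. norm (c n) * \<epsilon> ^ n)" and \<epsilon>: "\<epsilon> > 0"
  shows "(\<lambda>s. \<Sum>n. c n * of_real \<epsilon> ^ n * rGamma_quot n s) holomorphic_on UNIV"
proof (rule holomorphic_uniform_sequence)
  show "(\<lambda>s. \<Sum>n<k. c n * of_real \<epsilon> ^ n * rGamma_quot n s) holomorphic_on UNIV" for k
    by (intro holomorphic_intros)
  fix x :: complex
  have "bounded (rGamma ` cball x 1)"
    by (intro compact_imp_bounded compact_continuous_image holomorphic_on_imp_continuous_on
          holomorphic_intros) auto
  then obtain B where B: "\<And>s. s \<in> cball x 1 \<Longrightarrow> norm (rGamma s) \<le> B"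
    unfolding bounded_iff by blast
  have "uniform_limit (cball x 1) (\<lambda>k s. \<Sum>n<k. c n * of_real \<epsilon> ^ n * rGamma_quot n s)
          (\<lambda>s. \<Sum>n. c n * of_real \<epsilon> ^ n * rGamma_quot n s) sequentially"
  proof (rule Weierstrass_m_test_ev)
    show "summable (\<lambda>n. norm (c n) * \<epsilon> ^ n * B)"
      using c by (rule summable_mult2)
    show "\<forall>\<^sub>F n in sequentially. \<forall>s\<in>cball x 1.
            norm (c n * of_real \<epsilon> ^ n * rGamma_quot n s) \<le> norm (c n) * \<epsilon> ^ n * B"
      \<comment> \<open>On the disc \<open>norm s \<le> norm x + 1\<close>, so this threshold leaves
        a margin of 1 in \<open>norm (s + n) \<ge> n - norm s\<close>.\<close>
      using eventually_ge_at_top[of "nat \<lceil>norm x + 2\<rceil>"]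
    proof eventually_elim
      case (elim n)
      show ?case
      proof
        fix s assume s: "s \<in> cball x 1"
        have "norm s \<le> norm x + 1"
          using s norm_triangle_sub[of s x] by (auto simp: dist_norm norm_minus_commute)
        moreover have "real n \<ge> norm x + 2" using elim by linarith
        moreover have "norm (of_nat n :: complex) \<le> norm (s + of_nat n) + norm s"
          using norm_triangle_ineq4[of "s + of_nat n" s] by simp
        ultimately have "norm (s + of_nat n) \<ge> 1" by simp
        then have "norm (rGamma_quot n s) \<le> norm (s + of_nat n) * norm (rGamma_quot n s)"
          using mult_right_mono[of 1 "norm (s + of_nat n)" "norm (rGamma_quot n s)"] by simp
        also have "\<dots> = norm (rGamma s)"
          by (simp flip: norm_mult add: rGamma_quot_mult)
        also have "\<dots> \<le> B" by (rule B[OF s])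
        finally show "norm (c n * of_real \<epsilon> ^ n * rGamma_quot n s) \<le> norm (c n) * \<epsilon> ^ n * B"
          using \<epsilon> by (auto simp: norm_mult norm_power intro!: mult_left_mono)
      qed
    qed
  qed
  then show "\<exists>d>0. cball x d \<subseteq> UNIV \<and> uniform_limit (cball x d)
      (\<lambda>k s. \<Sum>n<k. c n * of_real \<epsilon> ^ n * rGamma_quot n s)
      (\<lambda>s. \<Sum>n. c n * of_real \<epsilon> ^ n * rGamma_quot n s) sequentially"
    by (intro exI[of _ 1]) auto
qed auto

text \<open>The expansion of \<open>g\<close> is integrated term by term, and multiplying by
  \<open>rGamma s\<close> turns each \<open>1 / (s + n)\<close> into \<open>rGamma_quot n s\<close>.
  Since \<open>c\<close> vanishes below \<open>N\<close>, only exponents \<open>s + n\<close> with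
  positive real part occur.\<close>

lemma
  fixes c :: "nat \<Rightarrow> complex" and \<epsilon> :: real and g :: "real \<Rightarrow> complex"
  assumes c: "summable (\<lambda>n. norm (c n) * \<epsilon> ^ n)" and \<epsilon>: "\<epsilon> > 0"
    and c_0: "\<And>n. n < N \<Longrightarrow> c n = 0" and s: "Re s > - real N"
    and g: "\<And>t. 0 < t \<Longrightarrow> t \<le> \<epsilon> \<Longrightarrow> (\<lambda>n. c n * of_real t ^ n) sums g t"
  shows mellin_head_integrable:
      "set_integrable lborel {0<..\<epsilon>} (\<lambda>t. of_real t powr (s - 1) * g t)"
    and mellin_head_eq:
      "rGamma s * (LINT t:{0<..\<epsilon>}|lborel. of_real t powr (s - 1) * g t) =
         of_real \<epsilon> powr s * (\<Sum>n. c n * of_real \<epsilon> ^ n * rGamma_quot n s)"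
proof -
  define f where "f = (\<lambda>n t. c n * (indicator {0<..\<epsilon>} t *\<^sub>R (complex_of_real t powr (s + of_nat n - 1))))"
  have pos: "Re (s + of_nat n) > 0" if "n \<ge> N" for n using s that by simp
  have f_int: "integrable lborel (f n)" for n
  proof (cases "n < N")
    case False
    then show ?thesis
      using set_integrable_powr[OF pos \<epsilon>, of n]
      by (simp add: f_def set_integrable_def del: mult_scaleR_right)
  qed (simp add: f_def c_0)
  have f_LINT: "integral\<^sup>L lborel (f n) = c n * (of_real \<epsilon> powr (s + of_nat n) / (s + of_nat n))" for n
  proof (cases "n < N")
    case False
    then show ?thesis
      using set_integral_powr[OF pos \<epsilon>, of n]
      by (simp add: f_def set_lebesgue_integral_def del: mult_scaleR_right)
  qed (simp add: f_def c_0)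
  have f_norm: "(LINT t|lborel. norm (f n t)) = norm (c n) * (\<epsilon> powr (Re s + n) / (Re s + n))" for n
  proof (cases "n < N")
    case False
    have "norm (f n t) = norm (c n) *
        (indicator {0<..\<epsilon>} t *\<^sub>R norm (complex_of_real t powr (s + of_nat n - 1)))" for t
      by (simp add: f_def norm_mult)
    with False show ?thesis
      using set_integral_norm_powr[OF pos \<epsilon>, of n]
      by (simp add: set_lebesgue_integral_def del: real_scaleR_def mult_scaleR_right)
  qed (simp add: f_def c_0)
  have powr_plus: "complex_of_real t powr (s + of_nat n - 1) = of_real t powr (s - 1) * of_real t ^ n"
    if "t > 0" for t n
    using that powr_add[of "complex_of_real t" "s - 1" "of_nat n"] by (simp add: algebra_simps)
  have f_sums: "(\<lambda>n. f n t) sums (indicator {0<..\<epsilon>} t *\<^sub>R (of_real t powr (s - 1) * g t))" for t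
  proof (cases "t \<in> {0<..\<epsilon>}")
    case True
    then show ?thesis
      using sums_mult[OF g[of t], of "of_real t powr (s - 1)"] by (simp add: f_def powr_plus mult_ac)
  qed (simp add: f_def)
  have sum_norm: "summable (\<lambda>n. norm (f n t))" for t
  proof (cases "t \<in> {0<..\<epsilon>}")
    case True
    have "summable (\<lambda>n. norm (of_real t powr (s - 1)) * (norm (c n) * t ^ n))"
    proof (intro summable_mult summable_comparison_test[OF _ c] exI[of _ 0] allI impI)
      show "norm (norm (c n) * t ^ n) \<le> norm (c n) * \<epsilon> ^ n" for n
        using True by (auto simp: norm_mult norm_power intro!: mult_left_mono power_mono)
    qed
    then show ?thesis using True by (simp add: f_def powr_plus norm_mult norm_power mult_ac)
  qed (simp add: f_def)
  have sum_int: "summable (\<lambda>n. LINT t|lborel. norm (f n t))"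
    unfolding f_norm
  proof (rule summable_comparison_test)
    \<comment> \<open>From \<open>n = N\<close> on, \<open>Re s + n\<close> is at least the positive
      number \<open>Re s + N\<close>, so one constant bounds all the denominators.\<close>
    show "\<exists>M. \<forall>n\<ge>M. norm (norm (c n) * (\<epsilon> powr (Re s + n) / (Re s + n))) \<le>
        (norm (c n) * \<epsilon> ^ n) * (\<epsilon> powr Re s / (Re s + N))"
    proof (intro exI allI impI)
      fix n assume n: "n \<ge> N"
      have "\<epsilon> powr (Re s + n) / (Re s + n) = \<epsilon> ^ n * \<epsilon> powr Re s / (Re s + n)"
        using \<epsilon> by (simp add: powr_add powr_realpow)
      also have "\<dots> \<le> \<epsilon> ^ n * \<epsilon> powr Re s / (Re s + N)"
        using n s \<epsilon> by (intro divide_left_mono mult_pos_pos) auto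
      finally have "norm (c n) * (\<epsilon> powr (Re s + n) / (Re s + n)) \<le>
          norm (c n) * (\<epsilon> ^ n * \<epsilon> powr Re s / (Re s + N))"
        by (rule mult_left_mono) auto
      then show "norm (norm (c n) * (\<epsilon> powr (Re s + n) / (Re s + n))) \<le>
        (norm (c n) * \<epsilon> ^ n) * (\<epsilon> powr Re s / (Re s + N))"
        using n s by (simp add: abs_mult)
    qed
    show "summable (\<lambda>n. (norm (c n) * \<epsilon> ^ n) * (\<epsilon> powr Re s / (Re s + N)))"
      using c by (rule summable_mult2)
  qed
  have eq: "(\<lambda>t. \<Sum>n. f n t) = (\<lambda>t. indicator {0<..\<epsilon>} t *\<^sub>R (of_real t powr (s - 1) * g t))"
    using f_sums by (intro ext sums_unique[symmetric])
  show "set_integrable lborel {0<..\<epsilon>} (\<lambda>t. of_real t powr (s - 1) * g t)"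
    using integrable_suminf[OF f_int _ sum_int] sum_norm by (simp add: set_integrable_def eq)
  have "(\<lambda>n. integral\<^sup>L lborel (f n)) sums (LINT t:{0<..\<epsilon>}|lborel. of_real t powr (s - 1) * g t)"
    using sums_integral[OF f_int _ sum_int] sum_norm by (simp add: set_lebesgue_integral_def eq)
  from sums_mult[OF this, of "rGamma s"]
  have 1: "(\<lambda>n. of_real \<epsilon> powr s * (c n * of_real \<epsilon> ^ n * rGamma_quot n s)) sums
      (rGamma s * (LINT t:{0<..\<epsilon>}|lborel. of_real t powr (s - 1) * g t))"
  proof (rule sums_cong[THEN iffD1, rotated])
    fix n
    show "rGamma s * integral\<^sup>L lborel (f n) =
        of_real \<epsilon> powr s * (c n * of_real \<epsilon> ^ n * rGamma_quot n s)"
    proof (cases "n < N")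
      case False
      then have "s + of_nat n \<noteq> 0" using pos[of n] by (auto simp: complex_eq_iff)
      then have "rGamma_quot n s = rGamma s / (s + of_nat n)"
        using rGamma_quot_mult[of s n] by (simp add: eq_divide_eq mult.commute)
      then show ?thesis
        using \<epsilon> by (simp add: f_LINT powr_add)
    qed (simp add: f_LINT c_0)
  qed
  have "of_real \<epsilon> powr s \<noteq> 0" using \<epsilon> by simp
  then have "summable (\<lambda>n. c n * of_real \<epsilon> ^ n * rGamma_quot n s)"
    using summable_mult_D[OF sums_summable[OF 1]] by blast
  from suminf_mult[OF this, of "of_real \<epsilon> powr s"] 1
  show "rGamma s * (LINT t:{0<..\<epsilon>}|lborel. of_real t powr (s - 1) * g t) =
         of_real \<epsilon> powr s * (\<Sum>n. c n * of_real \<epsilon> ^ n * rGamma_quot n s)"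
    by (simp add: sums_iff)
qed

section \<open>The Mellin integral away from 0, and continuation of the whole transform\<close>

lemma set_integrable_powr_mult_exp:
  fixes p \<kappa> :: real
  assumes "p > -1" "\<kappa> > 0"
  shows "set_integrable lborel {0<..} (\<lambda>t. t powr p * exp (- \<kappa> * t))"
proof -
  \<comment> \<open>This is the rescaled Euler integrand for \<open>Gamma (p + 1)\<close>; its
    absolute value is the function in question.\<close>
  have "set_integrable lborel {0<..} 
      (\<lambda>t. complex_of_real t powr (of_real (p + 1) - 1) / of_real (exp (\<kappa> * t)))"
    using assms
    by (intro set_integrable_lborel_if_continuous absolutely_integrable_Gamma_integral continuous_intros) auto
  then have "set_integrable lborel {0<..} 
      (\<lambda>t. norm (complex_of_real t powr (of_real (p + 1) - 1) / of_real (exp (\<kappa> * t))))"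
    by (rule set_integrable_norm)
  also have "?this \<longleftrightarrow> ?thesis"
    by (rule set_integrable_cong) (auto simp: norm_divide norm_of_real_powr exp_minus field_simps)
  finally show ?thesis .
qed

text \<open>Integrals over the compact intervals from \<open>\<epsilon>\<close> to
  \<open>\<epsilon> + n\<close> are entire by differentiation under the integral sign. A majorant
  independent of \<open>s\<close> in a disc makes them converge locally uniformly to the full
  tail.\<close>

lemma
  fixes g :: "real \<Rightarrow> complex" and \<epsilon> \<kappa> K :: real
  assumes cont: "continuous_on {\<epsilon>..} g" and \<epsilon>: "\<epsilon> > 0" and \<kappa>: "\<kappa> > 0"
    and bound: "\<And>t. t \<ge> \<epsilon> \<Longrightarrow> norm (g t) \<le> K * exp (- \<kappa> * t)"
  shows mellin_tail_integrable:
      "set_integrable lborel {\<epsilon>..} (\<lambda>t. of_real t powr (s - 1) * g t)"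
    and mellin_tail_holomorphic:
      "(\<lambda>s. LINT t:{\<epsilon>..}|lborel. of_real t powr (s - 1) * g t) holomorphic_on UNIV"
proof -
  \<comment> \<open>A common majorant for all \<open>s\<close> with
    \<open>\<bar>Re s\<bar> \<le> R\<close>: the first power handles \<open>t \<ge> 1\<close>, the
    second handles \<open>t\<close> between \<open>\<epsilon>\<close> and 1.\<close>
  define H where "H = (\<lambda>R t. (t powr (R + 1) + \<epsilon> powr (- (R + 1))) * (K * exp (- \<kappa> * t)))"
  define F where "F = (\<lambda>s t. of_real t powr (s - 1) * g t)"
  have H_int: "set_integrable lborel {\<epsilon>..} (H R)" if "R \<ge> 0" for R
  proof -
    have "set_integrable lborel {0<..} (\<lambda>t. K * (t powr (R + 1) * exp (- \<kappa> * t)) +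
        (K * \<epsilon> powr (- (R + 1))) * (t powr 0 * exp (- \<kappa> * t)))"
      using that \<kappa>
      by (intro set_integral_add set_integrable_mult_right set_integrable_powr_mult_exp) auto
    then have "set_integrable lborel {\<epsilon>..} (\<lambda>t. K * (t powr (R + 1) * exp (- \<kappa> * t)) +
        (K * \<epsilon> powr (- (R + 1))) * (t powr 0 * exp (- \<kappa> * t)))"
      by (rule set_integrable_subset) (use \<epsilon> in auto)
    also have "?this \<longleftrightarrow> ?thesis"
      using \<epsilon> by (intro set_integrable_cong) (auto simp: H_def distrib_left distrib_right mult_ac)
    finally show ?thesis .
  qed
  have F_le: "norm (F s t) \<le> H R t" if R: "\<bar>Re s\<bar> \<le> R" and t: "t \<ge> \<epsilon>" for s R t
  proof -
    have "t powr (Re s - 1) \<le> t powr (R + 1) + \<epsilon> powr (- (R + 1))"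
    proof (cases "t \<ge> 1")
      case True
      then have "t powr (Re s - 1) \<le> t powr (R + 1)" using R by (intro powr_mono) auto
      then show ?thesis by (simp add: add_increasing2)
    next
      case False
      then have "t powr (Re s - 1) \<le> t powr (- (R + 1))"
        using R t \<epsilon> by (intro powr_mono') auto
      also have "\<dots> \<le> \<epsilon> powr (- (R + 1))" using R t \<epsilon> by (intro powr_mono2') auto
      finally show ?thesis by (simp add: add_increasing)
    qed
    then show ?thesis
      using bound[OF t] t \<epsilon> by (auto simp: F_def H_def norm_mult norm_of_real_powr intro!: mult_mono)
  qed
  have F_cont: "continuous_on {\<epsilon>..} (F s)" for s
    unfolding F_def using \<epsilon> by (intro continuous_intros cont) auto
  have F_int: "set_integrable lborel {\<epsilon>..} (F s)" for s
  proof (rule set_integrable_bound[OF H_int[of "\<bar>Re s\<bar>"]])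
    show "set_borel_measurable lborel {\<epsilon>..} (F s)"
      using borel_measurable_continuous_on_indicator[OF _ F_cont]
      by (simp add: set_borel_measurable_def)
    show "AE t in lborel. t \<in> {\<epsilon>..} \<longrightarrow> norm (F s t) \<le> norm (H \<bar>Re s\<bar> t)"
      using F_le[of s "\<bar>Re s\<bar>"] by (auto intro!: order_trans[OF _ abs_ge_self])
  qed auto
  then show "set_integrable lborel {\<epsilon>..} (\<lambda>t. of_real t powr (s - 1) * g t)" for s
    by (simp add: F_def)
  define T where "T = (\<lambda>n s. LINT t:{\<epsilon>..\<epsilon> + real n}|lborel. F s t)"
  have "(\<lambda>s. LINT t:{\<epsilon>..}|lborel. F s t) holomorphic_on UNIV"
  proof (rule holomorphic_uniform_sequence)
    show "T n holomorphic_on UNIV" for n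
    proof -
      \<comment> \<open>For positive \<open>t\<close> the power is an exponential in
        \<open>s\<close>, whose derivative in \<open>s\<close> just brings down
        \<open>ln t\<close>.\<close>
      define f where "f = (\<lambda>s t. exp ((s - 1) * of_real (ln t)) * g t)"
      have Ff: "F s t = f s t" if "t \<in> {\<epsilon>..\<epsilon> + real n}" for s t
        using that \<epsilon> by (auto simp: F_def f_def powr_def Ln_of_real)
      have cont': "continuous_on {\<epsilon>..\<epsilon> + real n} g"
        by (rule continuous_on_subset[OF cont]) auto
      have "(\<lambda>s. integral (cbox \<epsilon> (\<epsilon> + real n)) (f s)) holomorphic_on UNIV"
      proof (rule leibniz_rule_holomorphic)
        show "((\<lambda>s. f s t) has_field_derivative of_real (ln t) * f s t) (at s within UNIV)" for s t
          unfolding f_def by (auto intro!: derivative_eq_intros)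
        show "f s integrable_on cbox \<epsilon> (\<epsilon> + real n)" for s
          unfolding f_def using \<epsilon> by (intro integrable_continuous continuous_intros) (auto simp: cont')
        have "continuous_on (UNIV \<times> cbox \<epsilon> (\<epsilon> + real n)) (\<lambda>p. g (snd p))"
          by (rule continuous_on_compose2[OF cont' continuous_on_snd]) auto
        then show "continuous_on (UNIV \<times> cbox \<epsilon> (\<epsilon> + real n)) (\<lambda>(s, t). of_real (ln t) * f s t)"
          unfolding f_def case_prod_unfold using \<epsilon> by (intro continuous_intros) auto
      qed auto
      also have "(\<lambda>s. integral (cbox \<epsilon> (\<epsilon> + real n)) (f s)) = T n"
      proof
        fix s
        have "set_integrable lborel {\<epsilon>..\<epsilon> + real n} (F s)"
          by (rule set_integrable_subset[OF F_int]) auto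
        then have "T n s = integral {\<epsilon>..\<epsilon> + real n} (F s)"
          unfolding T_def by (rule set_borel_integral_eq_integral)
        also have "\<dots> = integral {\<epsilon>..\<epsilon> + real n} (f s)"
          by (rule integral_cong) (rule Ff)
        finally show "integral (cbox \<epsilon> (\<epsilon> + real n)) (f s) = T n s" by simp
      qed
      finally show ?thesis .
    qed
    fix x :: complex
    define R where "R = norm x + 1"
    have R: "R \<ge> 0" by (simp add: R_def)
    \<comment> \<open>The tail of the integral of the majorant bounds the truncation error uniformly
      on the disc and tends to 0 by dominated convergence.\<close>
    define a where "a = (\<lambda>n. LINT t:{\<epsilon> + real n<..}|lborel. H R t)"
    have "a \<longlonglongrightarrow> (LINT t::real|lborel. 0)"
      unfolding a_def set_lebesgue_integral_def
    proof (rule integral_dominated_convergence)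
      show "integrable lborel (\<lambda>t. norm (indicator {\<epsilon>..} t *\<^sub>R H R t))"
        using H_int[OF R] unfolding set_integrable_def by (rule integrable_norm)
      show "(\<lambda>t. indicator {\<epsilon> + real n<..} t *\<^sub>R H R t) \<in> borel_measurable lborel" for n
        unfolding H_def by measurable
      show "AE t in lborel. (\<lambda>n. indicator {\<epsilon> + real n<..} t *\<^sub>R H R t) \<longlonglongrightarrow> 0"
      proof (rule AE_I2)
        fix t :: real
        have "eventually (\<lambda>n. indicator {\<epsilon> + real n<..} t *\<^sub>R H R t = 0) sequentially"
          using eventually_ge_at_top[of "nat \<lceil>t\<rceil>"]
          by eventually_elim (use \<epsilon> in \<open>auto simp: indicator_def\<close>)
        then show "(\<lambda>n. indicator {\<epsilon> + real n<..} t *\<^sub>R H R t) \<longlonglongrightarrow> 0"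
          by (rule tendsto_eventually)
      qed
    qed (auto simp: indicator_def)
    then have a: "a \<longlonglongrightarrow> 0" by simp
    have diff: "norm (T n s - (LINT t:{\<epsilon>..}|lborel. F s t)) \<le> a n" if s: "s \<in> cball x 1" for n s
    proof -
      have "\<bar>Re s\<bar> \<le> R"
        using s abs_Re_le_cmod[of s] norm_triangle_sub[of s x]
        by (auto simp: R_def dist_norm norm_minus_commute)
      note le = F_le[OF this]
      have sub: "set_integrable lborel {\<epsilon> + real n<..} f" if "set_integrable lborel {\<epsilon>..} f" 
        for f :: "real \<Rightarrow> 'b :: {banach, second_countable_topology}"
        by (rule set_integrable_subset[OF that]) auto
      have "(LINT t:{\<epsilon>..\<epsilon> + real n} \<union> {\<epsilon> + real n<..}|lborel. F s t) =
          T n s + (LINT t:{\<epsilon> + real n<..}|lborel. F s t)"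
        unfolding T_def
        by (intro set_integral_Un set_integrable_subset[OF F_int[of s]]) auto
      moreover have "{\<epsilon>..\<epsilon> + real n} \<union> {\<epsilon> + real n<..} = {\<epsilon>..}" by auto
      ultimately have "norm (T n s - (LINT t:{\<epsilon>..}|lborel. F s t)) =
          norm (LINT t:{\<epsilon> + real n<..}|lborel. F s t)"
        by (simp add: norm_minus_commute)
      also have "\<dots> \<le> (LINT t:{\<epsilon> + real n<..}|lborel. norm (F s t))"
        by (rule set_integral_norm_bound[OF sub[OF F_int]])
      also have "\<dots> \<le> a n"
        unfolding a_def
        by (intro set_integral_mono set_integrable_norm sub F_int H_int R le) auto
      finally show ?thesis .
    qed
    have "uniform_limit (cball x 1) T (\<lambda>s. LINT t:{\<epsilon>..}|lborel. F s t) sequentially"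
    proof (rule uniform_limitI)
      fix e :: real assume "e > 0"
      then have "eventually (\<lambda>n. a n < e) sequentially"
        by (rule order_tendstoD[OF a])
      then show "\<forall>\<^sub>F n in sequentially. \<forall>s\<in>cball x 1. dist (T n s) (LINT t:{\<epsilon>..}|lborel. F s t) < e"
        by eventually_elim (auto simp: dist_norm intro!: le_less_trans[OF diff])
    qed
    then show "\<exists>d>0. cball x d \<subseteq> UNIV \<and>
        uniform_limit (cball x d) T (\<lambda>s. LINT t:{\<epsilon>..}|lborel. F s t) sequentially"
      by (intro exI[of _ 1]) auto
  qed auto
  then show "(\<lambda>s. LINT t:{\<epsilon>..}|lborel. of_real t powr (s - 1) * g t) holomorphic_on UNIV"
    by (simp add: F_def)
qed

text \<open>The head contributes a series in \<open>rGamma_quot\<close> and the tail an entire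
  integral times \<open>rGamma\<close>. At \<open>- m\<close> the reciprocal Gamma function kills
  the tail, and of the head only the \<open>m\<close>-th term remains.\<close>

lemma mellin_continuation:
  fixes g :: "real \<Rightarrow> complex" and c :: "nat \<Rightarrow> complex" and \<delta> \<kappa> K :: real
  assumes cont: "continuous_on {0<..} g"
    and decay: "\<And>t. t \<ge> 1 \<Longrightarrow> norm (g t) \<le> K * exp (- \<kappa> * t)" and \<kappa>: "\<kappa> > 0"
    and series: "\<And>t. 0 < t \<Longrightarrow> t < \<delta> \<Longrightarrow> (\<lambda>n. c n * of_real t ^ n) sums g t" and \<delta>: "\<delta> > 0"
    and c_0: "\<And>n. n < N \<Longrightarrow> c n = 0"
  shows "\<exists>E. E holomorphic_on UNIV \<and>
    (\<forall>s. Re s > - real N \<longrightarrow>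
       set_integrable lborel {0<..} (\<lambda>t. of_real t powr (s - 1) * g t) \<and>
       E s = rGamma s * (LINT t:{0<..}|lborel. of_real t powr (s - 1) * g t)) \<and>
    (\<forall>m. E (- of_nat m) = (-1) ^ m * fact m * c m)"
proof -
  \<comment> \<open>Halving leaves room: the series still converges at
    \<open>3 / 2 * \<epsilon> < \<delta>\<close>, hence absolutely at
    \<open>\<epsilon>\<close>.\<close>
  define \<epsilon> where "\<epsilon> = \<delta> / 2"
  have \<epsilon>: "\<epsilon> > 0" "\<epsilon> < \<delta>" using \<delta> by (auto simp: \<epsilon>_def)
  have "summable (\<lambda>n. c n * of_real (3 / 2 * \<epsilon>) ^ n)"
    using series[of "3 / 2 * \<epsilon>"] \<epsilon> sums_summable by (auto simp: \<epsilon>_def)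
  then have "summable (\<lambda>n. norm (c n * of_real \<epsilon> ^ n))"
    by (rule powser_insidea) (use \<epsilon> in \<open>auto simp: norm_mult\<close>)
  then have c_sum: "summable (\<lambda>n. norm (c n) * \<epsilon> ^ n)"
    using \<epsilon> by (simp add: norm_mult norm_power)
  have cont': "continuous_on {\<epsilon>..} g"
    by (rule continuous_on_subset[OF cont]) (use \<epsilon> in auto)
  \<comment> \<open>Decay is given only from 1 onwards; by continuity the weighted function is
    bounded on the compact remainder, which only enlarges the constant.\<close>
  have "compact ((\<lambda>t. norm (g t) * exp (\<kappa> * t)) ` {\<epsilon>..1})"
    by (intro compact_continuous_image continuous_intros continuous_on_subset[OF cont']) auto
  then have "bounded ((\<lambda>t. norm (g t) * exp (\<kappa> * t)) ` {\<epsilon>..1})"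
    by (rule compact_imp_bounded)
  then obtain K1 where K1: "\<And>t. t \<in> {\<epsilon>..1} \<Longrightarrow> norm (g t) * exp (\<kappa> * t) \<le> K1"
    unfolding bounded_iff by fastforce
  have bound: "norm (g t) \<le> max K K1 * exp (- \<kappa> * t)" if t: "t \<ge> \<epsilon>" for t
  proof -
    have "norm (g t) * exp (\<kappa> * t) \<le> max K K1"
    proof (cases "t \<ge> 1")
      case True
      with decay[of t] have "norm (g t) * exp (\<kappa> * t) \<le> K"
        by (simp add: exp_minus field_simps)
      then show ?thesis by simp
    qed (use K1[of t] t in auto)
    then show ?thesis by (simp add: exp_minus field_simps)
  qed
  note tail_int = mellin_tail_integrable[OF cont' \<epsilon>(1) \<kappa> bound]
  note tail_hol = mellin_tail_holomorphic[OF cont' \<epsilon>(1) \<kappa> bound]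
  define T where "T = (\<lambda>s. LINT t:{\<epsilon>..}|lborel. of_real t powr (s - 1) * g t)"
  define E where "E = (\<lambda>s. of_real \<epsilon> powr s * (\<Sum>n. c n * of_real \<epsilon> ^ n * rGamma_quot n s) + rGamma s * T s)"
  have "E holomorphic_on UNIV"
    unfolding E_def T_def using \<epsilon>
    by (intro holomorphic_intros tail_hol rGamma_quot_series c_sum) auto
  moreover have "set_integrable lborel {0<..} (\<lambda>t. of_real t powr (s - 1) * g t) \<and>
       E s = rGamma s * (LINT t:{0<..}|lborel. of_real t powr (s - 1) * g t)"
    if s: "Re s > - real N" for s
  proof -
    have ser: "(\<lambda>n. c n * of_real t ^ n) sums g t" if "0 < t" "t \<le> \<epsilon>" for t
      using that \<epsilon> by (intro series) auto
    note head_int = mellin_head_integrable[OF c_sum \<epsilon>(1) c_0 s ser]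
    note head_eq = mellin_head_eq[OF c_sum \<epsilon>(1) c_0 s ser]
    have Un: "{0<..\<epsilon>} \<union> {\<epsilon>..} = {0<..}" using \<epsilon> by auto
    have "set_integrable lborel ({0<..\<epsilon>} \<union> {\<epsilon>..}) (\<lambda>t. of_real t powr (s - 1) * g t)"
      by (intro set_integrable_Un head_int tail_int) auto
    moreover have "(LINT t:{0<..\<epsilon>} \<union> {\<epsilon>..}|lborel. of_real t powr (s - 1) * g t) =
        (LINT t:{0<..\<epsilon>}|lborel. of_real t powr (s - 1) * g t) + T s"
      unfolding T_def
    proof (intro set_integral_Un_AE head_int tail_int)
      show "AE t in lborel. \<not> (t \<in> {0<..\<epsilon>} \<and> t \<in> {\<epsilon>..})"
        using AE_lborel_singleton[of \<epsilon>] by eventually_elim auto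
    qed auto
    ultimately show ?thesis
      using head_eq by (simp add: Un E_def distrib_left)
  qed
  moreover have "E (- of_nat m) = (-1) ^ m * fact m * c m" for m
  proof -
    \<comment> \<open>In the surviving term \<open>\<epsilon> ^ m\<close> cancels against
      \<open>\<epsilon> powr (- m)\<close>.\<close>
    have "(\<Sum>n. c n * of_real \<epsilon> ^ n * rGamma_quot n (- of_nat m)) =
        (\<Sum>n\<in>{m}. c n * of_real \<epsilon> ^ n * rGamma_quot n (- of_nat m))"
      by (rule suminf_finite) (auto simp: rGamma_quot_minus_nat)
    moreover have "rGamma (- of_nat m :: complex) = 0" by (simp add: rGamma_eq_zero_iff)
    ultimately show ?thesis
      using \<epsilon> by (simp add: E_def rGamma_quot_minus_nat powr_minus field_simps)
  qed
  ultimately show ?thesis by blast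
qed

section \<open>The eta function\<close>

lemma powser_eq_0_imp_coeff_eq_0:
  fixes a :: "nat \<Rightarrow> 'a::{real_normed_field,banach}"
  assumes "s > 0" "\<And>x. x \<noteq> 0 \<Longrightarrow> norm x < s \<Longrightarrow> (\<lambda>n. a n * x ^ n) sums 0"
  shows "a n = 0"
  using assms(2)
\<comment> \<open>The constant coefficient is the limit at the excluded point 0; once it is known to
  vanish, dividing by \<open>x\<close> shifts the sequence.\<close>
proof (induction n arbitrary: a)
  case 0
  have "((\<lambda>_. 0) \<longlongrightarrow> a 0) (at (0::'a))"
    by (rule powser_limit_0_strong[OF assms(1) 0])
  then show ?case by (simp add: tendsto_const_iff)
next
  case (Suc n)
  have "((\<lambda>_. 0) \<longlongrightarrow> a 0) (at (0::'a))"
    by (rule powser_limit_0_strong[OF assms(1) Suc.prems])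
  then have "a 0 = 0" by (simp add: tendsto_const_iff)
  have "(\<lambda>n. a (Suc n) * x ^ n) sums 0" if "x \<noteq> 0" "norm x < s" for x
  proof -
    have "(\<lambda>n. a (Suc n) * x ^ Suc n) sums 0"
      using sums_Suc_iff[of "\<lambda>n. a n * x ^ n" 0] Suc.prems[OF that] \<open>a 0 = 0\<close>
      by (simp del: power_Suc)
    also have "(\<lambda>n. a (Suc n) * x ^ Suc n) = (\<lambda>n. x * (a (Suc n) * x ^ n))"
      by (simp add: mult_ac)
    finally show ?thesis
      using sums_mult_iff[OF that(1), of "\<lambda>n. a (Suc n) * x ^ n" 0] by simp
  qed
  then show ?case by (rule Suc.IH)
qed

text \<open>Two sequences satisfying the generating function identity differ by the coefficients of
  a power series that is 0 on a punctured disc, so the definite description is well defined.\<close>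

lemma multi_poly_bernoulli_eqI:
  assumes "\<forall>\<^sub>F t in at (0::complex). (\<lambda>n. B n * t ^ n / fact n) sums
             (multi_polylog ks (1 - exp (- t)) / (1 - exp (- t)))"
  shows "multi_poly_bernoulli ks = B"
  unfolding multi_poly_bernoulli_def
proof (rule the_equality[where a = B], fact assms)
  fix B'
  assume B': "\<forall>\<^sub>F t in at (0::complex). (\<lambda>n. B' n * t ^ n / fact n) sums
             (multi_polylog ks (1 - exp (- t)) / (1 - exp (- t)))"
  have "\<forall>\<^sub>F t in at 0. (\<lambda>n. (B' n - B n) / fact n * t ^ n) sums 0"
    using B' assms
  proof eventually_elim
    case (elim t)
    from sums_diff[OF this] show ?case by (simp add: diff_divide_distrib algebra_simps)
  qed
  then obtain d where d: "d > 0" 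
    "\<forall>t\<in>UNIV. t \<noteq> 0 \<and> dist t 0 < d \<longrightarrow> (\<lambda>n. (B' n - B n) / fact n * t ^ n) sums 0"
    unfolding eventually_at by (elim exE conjE)
  have "(B' n - B n) / fact n = 0" for n
    by (rule powser_eq_0_imp_coeff_eq_0[OF d(1)]) (use d(2) in simp)
  then show "B' = B" by auto
qed

text \<open>Raise \<open>t / b \<le> exp (t / b)\<close> to the power \<open>a\<close>, with
  \<open>b\<close> chosen so that \<open>a / b \<le> 1 / 2\<close>; the summand 1 in
  \<open>b\<close> keeps it positive when \<open>a = 0\<close>.\<close>

lemma power_le_exp_half:
  fixes t :: real
  assumes "t \<ge> 0"
  shows "t ^ a \<le> (2 * (real a + 1)) ^ a * exp (t / 2)"
proof -
  define b where "b = 2 * (real a + 1)"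
  have b: "b > 0" by (simp add: b_def)
  have "t / b \<le> exp (t / b)" using exp_ge_add_one_self[of "t / b"] by linarith
  then have "t \<le> b * exp (t / b)" using b by (simp add: field_simps)
  then have "t ^ a \<le> (b * exp (t / b)) ^ a" using assms by (rule power_mono)
  also have "\<dots> = b ^ a * exp (real a * (t / b))"
    by (simp only: power_mult_distrib exp_of_nat_mult)
  also have "\<dots> \<le> b ^ a * exp (t / 2)"
    using assms b by (auto simp: b_def field_simps)
  finally show ?thesis by (simp add: b_def)
qed

section \<open>Verifying the Mellin hypotheses for the eta integrand\<close>

lemma eta_continuation:
  assumes "ks \<noteq> []" and ks: "\<forall>k\<in>set ks. 1 \<le> k"
  shows "\<exists>E. (\<forall>s. Re s > 1 - real (length ks) \<longrightarrow>
           set_integrable lborel {0<..} (eta_integrand ks s) \<and> E s = eta_integral ks s) \<and>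
         E holomorphic_on UNIV \<and>
         (\<forall>m::nat. E (- of_nat m) = multi_poly_bernoulli ks m)"
proof -
  \<comment> \<open>The polylogarithm vanishes to order \<open>length ks\<close> at 0 and the
    division by \<open>1 - exp t\<close> removes one order; hence
    \<open>1 - length ks = - N\<close>.\<close>
  define N where "N = length ks - 1"
  have len: "length ks = Suc N" using assms(1) by (cases ks) (auto simp: N_def)
  define F where "F = polylog_fps ks"
  define Q where "Q = fps_shift (Suc N) F"
  define g where "g = (\<lambda>t::real. multi_polylog_ext ks (1 - exp (of_real t)) / (1 - exp (of_real t)))"
  have F_eq: "F = fps_X ^ Suc N * Q"
    by (rule fps_ext) (auto simp: F_def Q_def fps_X_power_mult_nth polylog_coeff_eq_0 len simp del: power_Suc)
  have "fps_conv_radius Q \<ge> 1"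
    using polylog_fps_conv_radius[OF ks] by (simp add: Q_def F_def)
  then have radQ: "norm z < fps_conv_radius Q" if "norm z < 1" for z :: complex
    using that by (meson ereal_less(3) less_le_trans)
  have F_Q: "eval_fps F z / z = z ^ N * eval_fps Q z" if "norm z < 1" "z \<noteq> 0" for z
  proof -
    have "eval_fps F z = z ^ Suc N * eval_fps Q z"
      unfolding F_eq using radQ[OF that(1)] by (subst eval_fps_mult) (simp_all del: power_Suc)
    then show ?thesis using that(2) by simp
  qed

  have "open ((\<lambda>t::complex. 1 - exp t) -` ball 0 1)"
    by (intro open_vimage continuous_intros) auto
  moreover have "0 \<in> (\<lambda>t::complex. 1 - exp t) -` ball 0 1" by simp
  ultimately obtain d where d: "d > 0" "ball 0 d \<subseteq> (\<lambda>t::complex. 1 - exp t) -` ball 0 1"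
    by (rule openE)
  \<comment> \<open>The radius \<open>d\<close> keeps \<open>1 - exp t\<close> inside the unit disc,
    and \<open>pi\<close> ensures that \<open>1 - exp t\<close> vanishes only at
    \<open>t = 0\<close>.\<close>
  define \<delta> where "\<delta> = min d pi"
  have \<delta>: "\<delta> > 0" using d pi_gt_zero by (simp add: \<delta>_def)
  have small: "norm (1 - exp t) < 1" if "norm t < \<delta>" for t :: complex
    using that d(2) by (auto simp: \<delta>_def)
  have nz: "1 - exp t \<noteq> 0" if "norm t < \<delta>" "t \<noteq> 0" for t :: complex
    using inj_onD[OF inj_on_exp_pi[of 0], of t 0] that pi_gt_zero by (auto simp: \<delta>_def)
  define k where "k = (\<lambda>t::complex. eval_fps Q (1 - exp t))"
  have k_hol: "k holomorphic_on ball 0 \<delta>"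
  proof -
    have "eval_fps Q \<circ> (\<lambda>t. 1 - exp t) holomorphic_on ball 0 \<delta>"
    proof (rule holomorphic_on_compose)
      show "eval_fps Q holomorphic_on (\<lambda>t. 1 - exp t) ` ball 0 \<delta>"
        by (rule holomorphic_on_eval_fps) (auto simp: radQ small)
    qed (intro holomorphic_intros)
    then show ?thesis by (simp add: k_def o_def)
  qed
  \<comment> \<open>The holomorphic extension over \<open>t = 0\<close> of the quotient in the
    integrand.\<close>
  define h where "h = (\<lambda>t::complex. (1 - exp t) ^ N * k t)"
  have h_hol: "h holomorphic_on ball 0 \<delta>"
    unfolding h_def by (intro holomorphic_intros k_hol)
  have h_eq: "eval_fps F (1 - exp t) / (1 - exp t) = h t" if "norm t < \<delta>" "t \<noteq> 0" for t
    using F_Q[OF small nz] that by (simp add: h_def k_def)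
  define c where "c = (\<lambda>n. (deriv ^^ n) h 0 / fact n)"
  have c_sums: "(\<lambda>n. c n * t ^ n) sums h t" if "norm t < \<delta>" for t
    using holomorphic_power_series[OF h_hol, of t] that by (simp add: c_def)
  \<comment> \<open>The series \<open>1 - fps_exp 1\<close> has no constant term, so its
    \<open>N\<close>-th power has no coefficients below \<open>N\<close>.\<close>
  have c_0: "c n = 0" if "n < N" for n
  proof -
    have "h has_fps_expansion (1 - fps_exp 1) ^ N * fps_expansion k 0"
      unfolding h_def
    proof (intro has_fps_expansion_mult has_fps_expansion_power has_fps_expansion_diff)
      show "k has_fps_expansion fps_expansion k 0"
        using \<delta> k_hol by (intro has_fps_expansion_fps_expansion[of "ball 0 \<delta>"]) auto
      show "exp has_fps_expansion fps_exp (1::complex)"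
        using has_fps_expansion_exp[of "1::complex"] by simp
    qed auto
    then have "c n = fps_nth ((1 - fps_exp 1) ^ N * fps_expansion k 0) n"
      by (simp add: fps_nth_fps_expansion c_def)
    also have "\<dots> = 0"
      using startsby_zero_power_prefix[of "1 - fps_exp (1::complex)" N] that
      by (auto simp: fps_mult_nth intro!: sum.neutral)
    finally show ?thesis .
  qed

  obtain C :: real and a :: nat where C:
    "\<And>t. t \<ge> 1 \<Longrightarrow> norm (multi_polylog_ext ks (1 - exp (of_real t))) \<le> C * t ^ a"
    using multi_polylog_ext_growth[OF ks] by blast
  have "0 \<le> C" using order_trans[OF norm_ge_zero C[of 1]] by simp
  \<comment> \<open>Here \<open>C\<close> and \<open>a\<close> come from the growth bound, the power
    from \<open>power_le_exp_half\<close>, and the 2 from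
    \<open>exp t / 2 \<le> exp t - 1\<close>.\<close>
  define K where "K = 2 * C * (2 * (real a + 1)) ^ a"
  have exp_neq: "exp (complex_of_real t) \<noteq> 1" if "t > 0" for t
    using that by (metis exp_of_real of_real_eq_1_iff exp_eq_one_iff less_irrefl)
  have decay: "norm (g t) \<le> K * exp (- (1 / 2) * t)" if t: "t \<ge> 1" for t
  proof -
    have exp: "exp t \<ge> 2" using exp_ge_add_one_self[of t] t by linarith
    have "norm (1 - exp (complex_of_real t)) = norm (complex_of_real (1 - exp t))"
      by (simp only: of_real_diff of_real_1 exp_of_real)
    then have norm: "norm (1 - exp (complex_of_real t)) = exp t - 1"
      using exp by (simp only: norm_of_real)
    have "norm (multi_polylog_ext ks (1 - exp (of_real t))) \<le> C * t ^ a" by (rule C[OF t])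
    also have "\<dots> \<le> C * ((2 * (real a + 1)) ^ a * exp (t / 2))"
      using t \<open>0 \<le> C\<close> by (intro mult_left_mono power_le_exp_half) auto
    also have "\<dots> = K * exp (- (1 / 2) * t) * (exp t / 2)"
      by (simp add: K_def flip: exp_add)
    also have "\<dots> \<le> K * exp (- (1 / 2) * t) * (exp t - 1)"
      using exp \<open>0 \<le> C\<close> by (intro mult_left_mono) (auto simp: K_def)
    finally show ?thesis
      using exp t by (simp add: g_def norm_divide norm pos_divide_le_eq)
  qed
  have g_cont: "continuous_on {0<..} g"
  proof -
    have "continuous_on {0<..} (\<lambda>t. 1 - exp (complex_of_real t))"
      by (intro continuous_intros)
    with holomorphic_on_imp_continuous_on[OF multi_polylog_ext_holomorphic[OF ks]]
    have "continuous_on {0<..} (\<lambda>t. multi_polylog_ext ks (1 - exp (complex_of_real t)))"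
      by (rule continuous_on_compose2) (rule image_subsetI, rule one_minus_exp_in_slit_plane)
    then show ?thesis
      unfolding g_def using exp_neq by (intro continuous_intros) auto
  qed
  have g_series: "(\<lambda>n. c n * of_real t ^ n) sums g t" if "0 < t" "t < \<delta>" for t
    using c_sums[of "of_real t"] h_eq[of "of_real t"] small[of "of_real t"] that
    by (simp add: g_def multi_polylog_ext_eq_eval_fps[OF ks] F_def)

  \<comment> \<open>The generating function is \<open>h (- t)\<close>: the reflection gives the
    sign, and passing to an exponential generating function gives the factorial.\<close>
  have "multi_poly_bernoulli ks = (\<lambda>m. (-1) ^ m * fact m * c m)"
  proof (rule multi_poly_bernoulli_eqI)
    have "\<forall>\<^sub>F t in at 0. t \<in> ball 0 \<delta> - {0::complex}"
      using \<delta> by (intro eventually_at_in_open) auto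
    then show "\<forall>\<^sub>F t in at 0. (\<lambda>n. (-1) ^ n * fact n * c n * t ^ n / fact n) sums
             (multi_polylog ks (1 - exp (- t)) / (1 - exp (- t)))"
    proof eventually_elim
      case (elim t)
      then have t: "norm (- t) < \<delta>" "- t \<noteq> 0" by auto
      have "(\<lambda>n. c n * (- t) ^ n) sums h (- t)" by (rule c_sums[OF t(1)])
      also have "h (- t) = multi_polylog ks (1 - exp (- t)) / (1 - exp (- t))"
        using h_eq[OF t] small[OF t(1)] by (simp add: multi_polylog_eq_eval_fps[OF ks] F_def)
      also have "(\<lambda>n. c n * (- t) ^ n) = (\<lambda>n. (-1) ^ n * fact n * c n * t ^ n / fact n)"
        by (auto simp: power_minus[of t])
      finally show ?case .
    qed
  qed
  moreover have "eta_integrand ks s = (\<lambda>t. of_real t powr (s - 1) * g t)" for s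
    by (simp add: eta_integrand_def[abs_def] g_def)
  moreover have "1 - real (length ks) = - real N" by (simp add: len)
  moreover obtain E where "E holomorphic_on UNIV"
    "\<forall>s. Re s > - real N \<longrightarrow> set_integrable lborel {0<..} (\<lambda>t. of_real t powr (s - 1) * g t) \<and>
       E s = rGamma s * (LINT t:{0<..}|lborel. of_real t powr (s - 1) * g t)"
    "\<forall>m. E (- of_nat m) = (-1) ^ m * fact m * c m"
    using mellin_continuation[where N = N, OF g_cont decay _ g_series \<delta> c_0] by auto
  ultimately show ?thesis
    by (intro exI[of _ E]) (simp add: eta_integral_def)
qed

theorem theorem2p3:
  "\<exists>\<eta> :: int list \<Rightarrow> complex \<Rightarrow> complex.
     (\<forall>ks. ks \<noteq> [] \<and> (\<forall>k\<in>set ks. 1 \<le> k) \<longrightarrow>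
        (\<forall>s. Re s > 1 - real (length ks) \<longrightarrow>
           set_integrable lborel {0<..} (eta_integrand ks s) \<and>
           \<eta> ks s = eta_integral ks s) \<and>
        \<eta> ks holomorphic_on UNIV \<and>
        (\<forall>m::nat. \<eta> ks (- of_nat m) = multi_poly_bernoulli ks m)) \<and>
     (\<forall>k\<ge>1. \<forall>m::nat. \<eta> [k] (- of_nat m) = multi_poly_bernoulli [k] m)"
proof -
  define P where "P = (\<lambda>ks E. (\<forall>s. Re s > 1 - real (length ks) \<longrightarrow>
           set_integrable lborel {0<..} (eta_integrand ks s) \<and> E s = eta_integral ks s) \<and>
        E holomorphic_on UNIV \<and>
        (\<forall>m::nat. E (- of_nat m) = multi_poly_bernoulli ks m))"
  \<comment> \<open>A single function of index and argument is required, so a continuation is chosen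
    for every index; its value at inadmissible indices is arbitrary.\<close>
  define \<eta> where "\<eta> = (\<lambda>ks. SOME E. P ks E)"
  have \<eta>: "P ks (\<eta> ks)" if "ks \<noteq> [] \<and> (\<forall>k\<in>set ks. 1 \<le> k)" for ks
  proof -
    have "\<exists>E. P ks E" unfolding P_def using that by (intro eta_continuation) auto
    then show ?thesis unfolding \<eta>_def by (rule someI_ex)
  qed
  have "\<eta> [k] (- of_nat m) = multi_poly_bernoulli [k] m" if "k \<ge> 1" for k and m :: nat
    using \<eta>[of "[k]"] that by (simp add: P_def)
  then show ?thesis
    using \<eta> by (intro exI[of _ \<eta>]) (simp add: P_def)
qed

end
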